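(* Let $V$, $M$, $M_1$, $M_2$, $\mathcal Z$, $\hat\mu$, $S$, $\mathcal N$, $\mathcal H_2$, $\mathcal U$, $\hat F_{\pm}$, $\check\Pi_{kl}$ and $\widehat C^{\mathrm{row\text{-}col}}_{kl}$ be as defined in the context. Suppose that: (1') (jointly exchangeable splitting mechanism) $(V^\sigma,M_1^\sigma,M_2^\sigma)\stackrel d=(V,M_1,M_2)$ for every $\sigma\in\Sigma_{\mathcal N}$, and additionally $M\ge M_1+M_2$ entrywise; (2) (network covariates) $\mathcal Z^\sigma=\zeta(\mathcal X^\sigma)$ for every permutation $\sigma$ of $[n]$; (3) either the sampling mechanism is deterministic node splitting, or the model is permutation invariant in the sense that $\boldsymbol{\hat\mu}^{\mathrm{split},\sigma}=\bigl(\hat\mu(\mathcal I^{\mathrm{split},\sigma}_{ij};\mathcal T^{\mathrm{split},\sigma})\bigr)_{1\le i,j\le n}$ for every permutation $\sigma$ of $[n]$. Then for any $(k,l)$ and any $t\in[0,1]$, $$P\left(\check\Pi_{kl}\le t\mid M_2(k,l)=1\right)\le t.$$ Consequently, for any $\alpha\in[0,1]$, $$P\left(Y_{kl}\in\widehat C^{\mathrm{row\text{-}col}}_{kl}\mid M_2(k,l)=1\right)\ge 1-\alpha.$$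
   Context: Let $[n]=\{1,\dots,n\}$. For an array $B=(B_{ij})_{i,j\in[n]}$ and a permutation $\sigma$ of $[n]$, $B^\sigma=(B_{\sigma(i),\sigma(j)})_{i,j\in[n]}$. Data: $V=(V_{ij})_{i,j\in[n]}$ with $V_{ij}=(Y_{ij},X_i,X_j,E_{ij})$, where $Y_{ij}$ is a real response, $X_i$ a node covariate, and $E_{ij}$ an edge covariate. $M$ is a random binary $n\times n$ matrix indicating which pairs are sampled. $M_1$ and $M_2$ are binary $n\times n$ matrices indicating membership of pairs in the training set and in the calibration set (which includes the test point), respectively. The array may be symmetric or asymmetric. $\mathcal N\subseteq[n]$ is the set of nodes that have nonzero probability of belonging to an edge in the graph corresponding to $M_2$, and $\Sigma_{\mathcal N}$ is the group of permutations $\sigma$ of $[n]$ with $\sigma(i)=i$ for all $i\notin\mathcal N$. Deterministic node splitting: for a fixed partition $D_1\cup D_2$ of $[n]$, $M_1(i,j)=M_{ij}\mathbf 1(i,j\in D_1)$ and $M_2(i,j)=M_{ij}\mathbf 1(i,j\in D_2)$. Network summary statistics: $\mathcal X=(\mathcal X_{ij})_{i,j\in[n]}$ with $\mathcal X_{ij}=(X_i,X_j,E_{ij},M_{ij})$, and $\mathcal Z=\zeta(\mathcal X)$ for a measurable function $\zeta$, where $\mathcal Z$ is an array with entries $(\mathcal Z_i,\mathcal Z_j,\mathcal Z_{ij})$ (node-level and pair-level summaries); below the subscript $ij$ on $\mathcal Z$ refers to the $(i,j)$ entry of this array. Model: with $\mathcal H_1=\{(i,j)\in[n]^2: M_1(i,j)=1\}$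 and $\mathcal H_2=\{(i,j)\in[n]^2: M_2(i,j)=1\}$, $$\mathcal T^{\mathrm{split}}=(V_{ij},\mathcal Z_{ij})_{(i,j)\in\mathcal H_1},\qquad \mathcal I^{\mathrm{split}}=(\mathcal X_{ij},\mathcal Z_{ij},M_2(i,j))_{(i,j)\in[n]^2},$$ and, for a permutation $\sigma$, $\mathcal T^{\mathrm{split},\sigma}=(V^\sigma_{ij},\mathcal Z^\sigma_{ij})_{(i,j):\, M_1^\sigma(i,j)=1}$ and $\mathcal I^{\mathrm{split},\sigma}=(\mathcal X^\sigma_{ij},\mathcal Z^\sigma_{ij},M^\sigma_2(i,j))_{(i,j)\in[n]^2}$. The matrix of fitted values $\boldsymbol{\hat\mu}^{\mathrm{split}}\in\mathbb R^{n\times n}$ has entries $\boldsymbol{\hat\mu}^{\mathrm{split}}_{ij}=\hat\mu(\mathcal I^{\mathrm{split}}_{ij};\mathcal T^{\mathrm{split}})$, and $\boldsymbol{\hat\mu}^{\mathrm{split},\sigma}$ is this matrix with rows and columns permuted by $\sigma$. Scores: for a nonconformity score $s:\mathbb R\times\mathbb R\to\mathbb R$, $S_{ij}=s(Y_{ij},\boldsymbol{\hat\mu}^{\mathrm{split}}_{ij})$. Row and column ranks: let $\mathcal H_2(k,\cdot)=\{(k,j)\in\mathcal H_2: j\in[n]\}$, $\mathcal H_2(\cdot,l)=\{(j,l)\in\mathcal H_2: j\in[n]\}$, and $$R_{kl}=\frac1{|\mathcal H_2(k,\cdot)|}\sum_{(k,j)\in\mathcal H_2}\mathbf 1\bigl(\{S_{kj}\ge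 S_{kl}\}\cap\{(k,l)\in\mathcal H_2\}\bigr),\quad C_{kl}=\frac1{|\mathcal H_2(\cdot,l)|}\sum_{(j,l)\in\mathcal H_2}\mathbf 1\bigl(\{S_{jl}\ge S_{kl}\}\cap\{(k,l)\in\mathcal H_2\}\bigr).$$ Let $\mathcal U=(\mathcal U_{ij})_{1\le i,j\le n}$ with $\mathcal U_{ij}=(R_{ij},C_{ij})$. Optimal transport map: let $\mu$ be a reference measure on $\mathbb R^2$ and let $(a_{ij})_{(i,j)\in\mathcal H_2}$ be a set of $|\mathcal H_2|$ low-discrepancy points from $\mu$ (a deterministic set of points whose empirical distribution approximates $\mu$ more accurately than a typical random sample of the same size). Let $\hat\nu=\frac1{|\mathcal H_2|}\sum_{(i,j)\in\mathcal H_2}\delta_{\mathcal U_{ij}}$ and $\hat\mu_{a}=\frac1{|\mathcal H_2|}\sum_{(i,j)\in\mathcal H_2}\delta_{a_{ij}}$, where $\delta_x$ is the point mass at $x$, and let $\hat F_{\pm}$ denote an optimal transport map carrying the entries $(\mathcal U_{ij})_{(i,j)\in\mathcal H_2}$ to the points $(a_{ij})_{(i,j)\in\mathcal H_2}$, that is, $$\hat F_{\pm}=\arg\min_{T:\ T(x)\sim\hat\mu_a}\int\|x-T(x)\|\,d\hat\nu(x),$$ where $T(x)\sim\hat\mu_a$ means that $T$ pushes $\hat\nu$ forward to $\hat\mu_a$ and $\|\cdot\|$ is the Euclidean norm. Put $S(u)=\|\hat F_{\pm}(u)\|$ and $$\check\Pi_{kl}=\frac1{|\mathcal H_2|}\sum_{(i,j)\in\mathcal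 H_2}\mathbf 1\bigl(S(\mathcal U_{ij})\ge S(\mathcal U_{kl})\bigr).$$ Prediction set: $\widehat C^{\mathrm{row\text{-}col}}_{kl}=\{y_{kl}:\check\Pi_{kl}>\alpha\}$, where $\check\Pi_{kl}$ is regarded as a function of the candidate value $y_{kl}$ substituted for $Y_{kl}$, with the ranks and the transport map recomputed for each candidate.
   Formalization: Joint exchangeability in (1') is required of (V,M,M_1,M_2) rather than (V,M_1,M_2), and calibration pairs are assumed off-diagonal (M_2(i,i)=0 almost surely); without either condition the claimed bound can fail. *)

theory Defs
  imports "HOL-Probability.Probability"
begin

text \<open>
  The nodes \<open>[n]\<close> are the elements of a finite type \<open>'n\<close>, with \<open>n = CARD('n)\<close>. Binary matrices
  are Boolean arrays.
\<close>

type_synonym ('n, 'a) arr = "'n \<times> 'n \<Rightarrow> 'a"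

definition permute :: "('n \<Rightarrow> 'n) \<Rightarrow> ('n, 'a) arr \<Rightarrow> ('n, 'a) arr" where
  "permute \<sigma> B = (\<lambda>(i, j). B (\<sigma> i, \<sigma> j))"

type_synonym ('x, 'e) obs = "real \<times> 'x \<times> 'x \<times> 'e"
type_synonym ('x, 'e) cov = "'x \<times> 'x \<times> 'e \<times> bool"
type_synonym ('z, 'w) summ = "'z \<times> 'z \<times> 'w"

definition obs_array ::
  "('n, real) arr \<Rightarrow> ('n \<Rightarrow> 'x) \<Rightarrow> ('n, 'e) arr \<Rightarrow> ('n, ('x, 'e) obs) arr" where
  "obs_array Y X E = (\<lambda>(i, j). (Y (i, j), X i, X j, E (i, j)))"

definition cov_array ::
  "('n \<Rightarrow> 'x) \<Rightarrow> ('n, 'e) arr \<Rightarrow> ('n, bool) arr \<Rightarrow> ('n, ('x, 'e) cov) arr" where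
  "cov_array X E M = (\<lambda>(i, j). (X i, X j, E (i, j), M (i, j)))"

definition summ_array :: "('n \<Rightarrow> 'z) \<Rightarrow> ('n, 'w) arr \<Rightarrow> ('n, ('z, 'w) summ) arr" where
  "summ_array u w = (\<lambda>(i, j). (u i, u j, w (i, j)))"

definition array_space :: "'a measure \<Rightarrow> ('n, 'a) arr measure" where
  "array_space S = Pi\<^sub>M UNIV (\<lambda>_. S)"

definition bool_space :: "bool measure" where
  "bool_space = count_space UNIV"

definition obs_space :: "'x measure \<Rightarrow> 'e measure \<Rightarrow> ('x, 'e) obs measure" where
  "obs_space SX SE = borel \<Otimes>\<^sub>M SX \<Otimes>\<^sub>M SX \<Otimes>\<^sub>M SE"

definition cov_space :: "'x measure \<Rightarrow> 'e measure \<Rightarrow> ('x, 'e) cov measure" where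
  "cov_space SX SE = SX \<Otimes>\<^sub>M SX \<Otimes>\<^sub>M SE \<Otimes>\<^sub>M bool_space"

definition summ_space :: "'z measure \<Rightarrow> 'w measure \<Rightarrow> ('z, 'w) summ measure" where
  "summ_space SZ SW = SZ \<Otimes>\<^sub>M SZ \<Otimes>\<^sub>M SW"

text \<open>The disjoint-union sigma-algebra on a measurable space with one extra point \<open>None\<close>.\<close>

definition option_space :: "'a measure \<Rightarrow> 'a option measure" where
  "option_space S =
     sigma (insert None (Some ` space S)) (insert {None} ((\<lambda>A. Some ` A) ` sets S))"

definition data_space ::
  "'x measure \<Rightarrow> 'e measure \<Rightarrow>
   (('n, ('x, 'e) obs) arr \<times> ('n, bool) arr \<times> ('n, bool) arr \<times> ('n, bool) arr) measure" where
  "data_space SX SE =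
     array_space (obs_space SX SE) \<Otimes>\<^sub>M
       array_space bool_space \<Otimes>\<^sub>M array_space bool_space \<Otimes>\<^sub>M array_space bool_space"

text \<open>The set \<open>\<N>\<close>; an edge of the graph of \<open>M\<^sub>2\<close> may touch \<open>i\<close> as either endpoint.\<close>

definition active_nodes :: "'o measure \<Rightarrow> ('o \<Rightarrow> ('n, bool) arr) \<Rightarrow> 'n set" where
  "active_nodes P M2 =
     {i. measure P {\<omega> \<in> space P. \<exists>j. M2 \<omega> (i, j) \<or> M2 \<omega> (j, i)} > 0}"

text \<open>
  The sampling matrix \<open>M\<close> has to be part of the exchangeable tuple: it enters the network summaries
  and the model input, also at the pairs that lie in neither the training nor the calibration set.
\<close>

definition exchangeable_split ::
  "'o measure \<Rightarrow> 'x measure \<Rightarrow> 'e measure \<Rightarrow> ('o \<Rightarrow> ('n, ('x, 'e) obs) arr) \<Rightarrow>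
   ('o \<Rightarrow> ('n, bool) arr) \<Rightarrow> ('o \<Rightarrow> ('n, bool) arr) \<Rightarrow> ('o \<Rightarrow> ('n, bool) arr) \<Rightarrow> bool" where
  "exchangeable_split P SX SE V M M1 M2 \<longleftrightarrow>
     (\<forall>\<sigma>. \<sigma> permutes active_nodes P M2 \<longrightarrow>
        distr P (data_space SX SE)
          (\<lambda>\<omega>. (permute \<sigma> (V \<omega>), permute \<sigma> (M \<omega>), permute \<sigma> (M1 \<omega>), permute \<sigma> (M2 \<omega>)))
        = distr P (data_space SX SE) (\<lambda>\<omega>. (V \<omega>, M \<omega>, M1 \<omega>, M2 \<omega>)))"

definition node_splitting ::
  "'o measure \<Rightarrow> ('o \<Rightarrow> ('n, bool) arr) \<Rightarrow> ('o \<Rightarrow> ('n, bool) arr) \<Rightarrow> ('o \<Rightarrow> ('n, bool) arr) \<Rightarrow>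
   bool" where
  "node_splitting P M M1 M2 \<longleftrightarrow>
     (\<exists>D1 D2. D1 \<union> D2 = UNIV \<and> D1 \<inter> D2 = {} \<and>
        (AE \<omega> in P. \<forall>i j.
           (M1 \<omega> (i, j) \<longleftrightarrow> M \<omega> (i, j) \<and> i \<in> D1 \<and> j \<in> D1) \<and>
           (M2 \<omega> (i, j) \<longleftrightarrow> M \<omega> (i, j) \<and> i \<in> D2 \<and> j \<in> D2)))"

text \<open>
  A family indexed by \<open>H\<^sub>1 = {(i, j). M\<^sub>1(i, j) = 1}\<close> is an array with value \<open>None\<close> off \<open>H\<^sub>1\<close>.
\<close>

definition train_split :: "('n, 'v) arr \<Rightarrow> ('n, 'z) arr \<Rightarrow> ('n, bool) arr \<Rightarrow>
    ('n, ('v \<times> 'z) option) arr" where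
  "train_split V Z M1 = (\<lambda>e. if M1 e then Some (V e, Z e) else None)"

definition input_split :: "('n, 'c) arr \<Rightarrow> ('n, 'z) arr \<Rightarrow> ('n, bool) arr \<Rightarrow>
    ('n, 'c \<times> 'z \<times> bool) arr" where
  "input_split \<X> Z M2 = (\<lambda>e. (\<X> e, Z e, M2 e))"

definition fitted :: "('i \<Rightarrow> 't \<Rightarrow> real) \<Rightarrow> ('n, 'i) arr \<Rightarrow> 't \<Rightarrow> ('n, real) arr" where
  "fitted \<mu>h I T = (\<lambda>e. \<mu>h (I e) T)"

definition model_space ::
  "'x measure \<Rightarrow> 'e measure \<Rightarrow> 'z measure \<Rightarrow> 'w measure \<Rightarrow>
   ((('x, 'e) cov \<times> ('z, 'w) summ \<times> bool) \<times>
    ('n, (('x, 'e) obs \<times> ('z, 'w) summ) option) arr) measure" where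
  "model_space SX SE SZ SW =
     (cov_space SX SE \<Otimes>\<^sub>M summ_space SZ SW \<Otimes>\<^sub>M bool_space) \<Otimes>\<^sub>M
     array_space (option_space (obs_space SX SE \<Otimes>\<^sub>M summ_space SZ SW))"

definition scores :: "(real \<Rightarrow> real \<Rightarrow> real) \<Rightarrow> ('n, real) arr \<Rightarrow> ('n, real) arr \<Rightarrow> ('n, real) arr"
  where "scores s Y m = (\<lambda>e. s (Y e) (m e))"

definition edges :: "('n, bool) arr \<Rightarrow> ('n \<times> 'n) set" where
  "edges B = {e. B e}"

definition row_of :: "('n \<times> 'n) set \<Rightarrow> 'n \<Rightarrow> ('n \<times> 'n) set" where
  "row_of H k = {(k, j) | j. (k, j) \<in> H}"

definition col_of :: "('n \<times> 'n) set \<Rightarrow> 'n \<Rightarrow> ('n \<times> 'n) set" where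
  "col_of H l = {(j, l) | j. (j, l) \<in> H}"

definition row_rank :: "('n \<times> 'n) set \<Rightarrow> ('n, real) arr \<Rightarrow> ('n, real) arr" where
  "row_rank H S = (\<lambda>(k, l).
     1 / real (card (row_of H k)) *
       (\<Sum>e \<in> row_of H k. of_bool (S e \<ge> S (k, l) \<and> (k, l) \<in> H)))"

definition col_rank :: "('n \<times> 'n) set \<Rightarrow> ('n, real) arr \<Rightarrow> ('n, real) arr" where
  "col_rank H S = (\<lambda>(k, l).
     1 / real (card (col_of H l)) *
       (\<Sum>e \<in> col_of H l. of_bool (S e \<ge> S (k, l) \<and> (k, l) \<in> H)))"

definition rank_pair :: "('n \<times> 'n) set \<Rightarrow> ('n, real) arr \<Rightarrow> ('n, real \<times> real) arr" where
  "rank_pair H S = (\<lambda>e. (row_rank H S e, col_rank H S e))"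

text \<open>\<open>empirical A f\<close> is \<open>1/|A| \<Sum>\<^bsub>x \<in> A\<^esub> \<delta>\<^bsub>f x\<^esub>\<close>; it is only meaningful for finite nonempty \<open>A\<close>.\<close>

definition empirical :: "'i set \<Rightarrow> ('i \<Rightarrow> 'a) \<Rightarrow> 'a pmf" where
  "empirical A f = map_pmf f (pmf_of_set A)"

text \<open>
  Optimal transport maps between two finitely supported distributions on the plane. Measurability
  of the map is no constraint here: on a finite support every map agrees with a Borel map.
  The norm of \<open>real \<times> real\<close> is the Euclidean norm.
\<close>

definition is_transport_map ::
  "(real \<times> real) pmf \<Rightarrow> (real \<times> real) pmf \<Rightarrow> (real \<times> real \<Rightarrow> real \<times> real) \<Rightarrow> bool" where
  "is_transport_map \<nu> \<rho> T \<longleftrightarrow> map_pmf T \<nu> = \<rho>"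

definition transport_cost :: "(real \<times> real) pmf \<Rightarrow> (real \<times> real \<Rightarrow> real \<times> real) \<Rightarrow> real" where
  "transport_cost \<nu> T = measure_pmf.expectation \<nu> (\<lambda>x. norm (x - T x))"

definition is_optimal_map ::
  "(real \<times> real) pmf \<Rightarrow> (real \<times> real) pmf \<Rightarrow> (real \<times> real \<Rightarrow> real \<times> real) \<Rightarrow> bool" where
  "is_optimal_map \<nu> \<rho> T \<longleftrightarrow>
     is_transport_map \<nu> \<rho> T \<and>
     (\<forall>T'. is_transport_map \<nu> \<rho> T' \<longrightarrow> transport_cost \<nu> T \<le> transport_cost \<nu> T')"

text \<open>
  A rule choosing an optimal map for the two distributions that define the transport problem. The
  minimiser need not be unique, and for tied rank pairs there may be no transport map at all; in
  the latter case nothing is required of the chosen map.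
\<close>

definition optimal_map_rule ::
  "((real \<times> real) pmf \<Rightarrow> (real \<times> real) pmf \<Rightarrow> real \<times> real \<Rightarrow> real \<times> real) \<Rightarrow> bool" where
  "optimal_map_rule F \<longleftrightarrow>
     (\<forall>\<nu> \<rho>. finite (set_pmf \<nu>) \<and> finite (set_pmf \<rho>) \<and> (\<exists>T. is_optimal_map \<nu> \<rho> T)
        \<longrightarrow> is_optimal_map \<nu> \<rho> (F \<nu> \<rho>))"

text \<open>
  \<open>a m\<close> enumerates, as \<open>a m 0, \<dots>, a m (m - 1)\<close>, the deterministic set of target points used when
  there are \<open>m\<close> calibration pairs. The points are arbitrary; in particular they may be low-discrepancy
  points of a reference measure. They depend on the calibration set only through its size.
\<close>

definition fitted_map ::
  "((real \<times> real) pmf \<Rightarrow> (real \<times> real) pmf \<Rightarrow> real \<times> real \<Rightarrow> real \<times> real) \<Rightarrow>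
   (nat \<Rightarrow> nat \<Rightarrow> real \<times> real) \<Rightarrow> ('n \<times> 'n) set \<Rightarrow> ('n, real) arr \<Rightarrow> real \<times> real \<Rightarrow> real \<times> real" where
  "fitted_map F a H S =
     F (empirical H (rank_pair H S)) (empirical {..<card H} (a (card H)))"

definition check_Pi ::
  "((real \<times> real) pmf \<Rightarrow> (real \<times> real) pmf \<Rightarrow> real \<times> real \<Rightarrow> real \<times> real) \<Rightarrow>
   (nat \<Rightarrow> nat \<Rightarrow> real \<times> real) \<Rightarrow> ('n \<times> 'n) set \<Rightarrow> ('n, real) arr \<Rightarrow> ('n, real) arr" where
  "check_Pi F a H S = (\<lambda>e.
     1 / real (card H) *
       (\<Sum>e' \<in> H. of_bool (norm (fitted_map F a H S (rank_pair H S e'))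
                         \<ge> norm (fitted_map F a H S (rank_pair H S e)))))"

text \<open>In a symmetric array \<open>(k, l)\<close> and \<open>(l, k)\<close> carry the same response.\<close>

definition subst_response ::
  "bool \<Rightarrow> 'n \<times> 'n \<Rightarrow> real \<Rightarrow> ('n, real) arr \<Rightarrow> ('n, real) arr" where
  "subst_response symm e y Y =
     (if symm then Y(e := y, prod.swap e := y) else Y(e := y))"

definition row_col_set ::
  "((real \<times> real) pmf \<Rightarrow> (real \<times> real) pmf \<Rightarrow> real \<times> real \<Rightarrow> real \<times> real) \<Rightarrow>
   (nat \<Rightarrow> nat \<Rightarrow> real \<times> real) \<Rightarrow> (real \<Rightarrow> real \<Rightarrow> real) \<Rightarrow> bool \<Rightarrow> real \<Rightarrow>
   ('n \<times> 'n) set \<Rightarrow> ('n, real) arr \<Rightarrow> ('n, real) arr \<Rightarrow> 'n \<times> 'n \<Rightarrow> real set" where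
  "row_col_set F a s symm \<alpha> H m Y e =
     {y. check_Pi F a H (scores s (subst_response symm e y Y) m) e > \<alpha>}"

end

theory Submission
  imports Defs
begin

text \<open>
  The rank pairs, and hence the optimal transport map and \<open>\<Pi>\<close>, are computed from the calibration
  pairs through permutation invariant operations, so \<open>\<Pi>\<close> is equivariant under relabelling of the
  nodes. By exchangeability, the events \<open>\<Pi>(e) \<le> t \<and> e \<in> H\<^sub>2\<close> have the same probability for all pairs
  \<open>e\<close> of distinct active nodes, and all other pairs lie in \<open>H\<^sub>2\<close> with probability zero. Averaging over
  \<open>e\<close>, the bound follows from the deterministic inequality \<open>|{e \<in> H\<^sub>2. \<Pi>(e) \<le> t}| \<le> t |H\<^sub>2|\<close>. Under
  node splitting every active node lies in \<open>D\<^sub>2\<close>, so relabelling active nodes does not change the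
  training data.
\<close>

section \<open>Equivariance of the ranks and of \<Pi> under relabelling of the nodes\<close>

lemma permute_apply: "permute \<sigma> B e = B (map_prod \<sigma> \<sigma> e)"
  by (cases e) (simp add: permute_def)

lemma edges_permute: "edges (permute \<sigma> B) = map_prod \<sigma> \<sigma> -` edges B"
  by (auto simp: edges_def permute_apply)

text \<open>The relabelling maps row \<open>k\<close> of the pulled-back edge set bijectively onto
  row \<open>\<sigma> k\<close> of \<open>H\<close>, so the normalising cardinality agrees and the
  sum can be reindexed.\<close>

lemma row_rank_permute:
  fixes \<sigma> :: "'n \<Rightarrow> 'n"
  assumes "bij \<sigma>"
  shows "row_rank (map_prod \<sigma> \<sigma> -` H) (permute \<sigma> S) e = row_rank H S (map_prod \<sigma> \<sigma> e)"
proof -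
  obtain k l where e: "e = (k, l)" by fastforce
  have inj: "inj_on (map_prod \<sigma> \<sigma>) A" for A
    using prod.inj_map[OF bij_is_inj[OF assms] bij_is_inj[OF assms]]
    by (rule inj_on_subset) simp
  have "map_prod \<sigma> \<sigma> ` row_of (map_prod \<sigma> \<sigma> -` H) k = row_of H (\<sigma> k)"
  proof (intro equalityI subsetI)
    fix x assume "x \<in> row_of H (\<sigma> k)"
    then obtain j where x: "x = (\<sigma> k, j)" "(\<sigma> k, j) \<in> H" by (auto simp: row_of_def)
    obtain j' where "j = \<sigma> j'" using bij_is_surj[OF assms] by (rule surjE)
    with x show "x \<in> map_prod \<sigma> \<sigma> ` row_of (map_prod \<sigma> \<sigma> -` H) k"
      by (force simp: row_of_def)
  qed (auto simp: row_of_def)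
  then have bij: "bij_betw (map_prod \<sigma> \<sigma>) (row_of (map_prod \<sigma> \<sigma> -` H) k) (row_of H (\<sigma> k))"
    using inj unfolding bij_betw_def by blast
  show ?thesis
    by (simp only: row_rank_def e prod.case map_prod_simp permute_apply vimage_eq
        bij_betw_same_card[OF bij] sum.reindex_bij_betw[OF bij, symmetric])
qed

lemma col_rank_permute:
  fixes \<sigma> :: "'n \<Rightarrow> 'n"
  assumes "bij \<sigma>"
  shows "col_rank (map_prod \<sigma> \<sigma> -` H) (permute \<sigma> S) e = col_rank H S (map_prod \<sigma> \<sigma> e)"
proof -
  obtain k l where e: "e = (k, l)" by fastforce
  have inj: "inj_on (map_prod \<sigma> \<sigma>) A" for A
    using prod.inj_map[OF bij_is_inj[OF assms] bij_is_inj[OF assms]]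
    by (rule inj_on_subset) simp
  have "map_prod \<sigma> \<sigma> ` col_of (map_prod \<sigma> \<sigma> -` H) l = col_of H (\<sigma> l)"
  proof (intro equalityI subsetI)
    fix x assume "x \<in> col_of H (\<sigma> l)"
    then obtain j where x: "x = (j, \<sigma> l)" "(j, \<sigma> l) \<in> H" by (auto simp: col_of_def)
    obtain j' where "j = \<sigma> j'" using bij_is_surj[OF assms] by (rule surjE)
    with x show "x \<in> map_prod \<sigma> \<sigma> ` col_of (map_prod \<sigma> \<sigma> -` H) l"
      by (force simp: col_of_def)
  qed (auto simp: col_of_def)
  then have bij: "bij_betw (map_prod \<sigma> \<sigma>) (col_of (map_prod \<sigma> \<sigma> -` H) l) (col_of H (\<sigma> l))"
    using inj unfolding bij_betw_def by blast
  show ?thesis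
    by (simp only: col_rank_def e prod.case map_prod_simp permute_apply vimage_eq
        bij_betw_same_card[OF bij] sum.reindex_bij_betw[OF bij, symmetric])
qed

lemma rank_pair_permute:
  assumes "bij \<sigma>"
  shows "rank_pair (map_prod \<sigma> \<sigma> -` H) (permute \<sigma> S) = rank_pair H S \<circ> map_prod \<sigma> \<sigma>"
  using assms by (auto simp: rank_pair_def row_rank_permute col_rank_permute)

text \<open>Both arguments of the rule \<open>F\<close> are unchanged: the empirical law of the rank
  pairs does not see the labels, and the target points depend on \<open>H\<close> only through its
  size. Hence the same map is selected on both sides, and it remains to reindex the outer
  sum.\<close>

lemma check_Pi_permute:
  fixes \<sigma> :: "'n::finite \<Rightarrow> 'n"
  assumes "bij \<sigma>"
  shows "check_Pi F a (map_prod \<sigma> \<sigma> -` H) (permute \<sigma> S) e = check_Pi F a H S (map_prod \<sigma> \<sigma> e)"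
proof -
  let ?\<tau> = "map_prod \<sigma> \<sigma>"
  have inj: "inj ?\<tau>" and surj: "surj ?\<tau>"
    using bij_is_inj[OF assms] bij_is_surj[OF assms] by (simp_all add: prod.inj_map map_prod_surj)
  have b: "bij_betw ?\<tau> (?\<tau> -` H) H"
    unfolding bij_betw_def using surj_image_vimage_eq[OF surj] inj_on_subset[OF inj] by blast
  show ?thesis
  \<comment> \<open>\<open>pmf_of_set\<close> is only meaningful on a nonempty set; for empty
    \<open>H\<close> both sides are empty sums and equal 0.\<close>
  proof (cases "H = {}")
    case False
    have "?\<tau> -` H \<noteq> {}"
      using False surj_image_vimage_eq[OF surj, of H] by blast
    then have "map_pmf ?\<tau> (pmf_of_set (?\<tau> -` H)) = pmf_of_set H"
      using map_pmf_of_set_inj[of ?\<tau> "?\<tau> -` H"] inj_on_subset[OF inj]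
        surj_image_vimage_eq[OF surj, of H] by (metis finite subset_UNIV)
    then have "empirical (?\<tau> -` H) (rank_pair H S \<circ> ?\<tau>) = empirical H (rank_pair H S)"
      by (simp only: empirical_def map_pmf_compose o_apply)
    then have "fitted_map F a (?\<tau> -` H) (permute \<sigma> S) = fitted_map F a H S"
      by (simp only: fitted_map_def rank_pair_permute[OF assms] bij_betw_same_card[OF b])
    then show ?thesis
      by (simp only: check_Pi_def rank_pair_permute[OF assms] bij_betw_same_card[OF b] o_apply
          sum.reindex_bij_betw[OF b, symmetric])
  qed (simp add: check_Pi_def)
qed

section \<open>Dependence on the order of the scores, the counting bound, and measurability of
  \<Pi>\<close>

text \<open>Scores enter only through the comparisons in the two ranks; the transport map and \<Pi>
  are computed from the ranks and \<open>H\<close>.\<close>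

lemma check_Pi_order_cong:
  assumes "\<And>e e'. S e \<le> S e' \<longleftrightarrow> S' e \<le> S' e'"
  shows "check_Pi F a H S = check_Pi F a H S'"
proof -
  have "rank_pair H S = rank_pair H S'"
    by (auto simp: rank_pair_def row_rank_def col_rank_def assms fun_eq_iff)
  then show ?thesis
    by (simp add: check_Pi_def fitted_map_def)
qed

text \<open>Among the pairs of \<open>H\<close> with \<Pi> at most \<open>t\<close>, take one whose
  transported rank pair has the smallest norm. All the others have at least that norm, so they are
  among the pairs that \<Pi> counts at the minimiser, and there are at most
  \<open>t * card H\<close> of those. Ties do no harm, since \<Pi> counts with a weak
  inequality.\<close>

lemma card_check_Pi_le:
  fixes H :: "('n::finite \<times> 'n) set"
  assumes "0 \<le> t"
  shows "real (card {e \<in> H. check_Pi F a H S e \<le> t}) \<le> t * real (card H)"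
proof (cases "{e \<in> H. check_Pi F a H S e \<le> t} = {}")
  case False
  define B where "B = {e \<in> H. check_Pi F a H S e \<le> t}"
  define f where "f e = norm (fitted_map F a H S (rank_pair H S e))" for e
  have "\<exists>e\<in>B. \<forall>e'\<in>B. f e \<le> f e'"
    using ex_is_arg_min_if_finite[of B f] False
    by (force simp: B_def[symmetric] is_arg_min_def not_less)
  then obtain e where e: "e \<in> B" "\<And>e'. e' \<in> B \<Longrightarrow> f e \<le> f e'" by blast
  have H: "card H > 0" using e(1) by (auto simp: B_def card_gt_0_iff)
  have "real (card B) \<le> real (card {e' \<in> H. f e \<le> f e'})"
    using e by (intro of_nat_mono card_mono) (auto simp: B_def)
  also have "\<dots> = real (card H) * check_Pi F a H S e"
    using H by (simp add: check_Pi_def f_def sum_of_bool_eq Int_def)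
  also have "\<dots> \<le> real (card H) * t"
    using e(1) by (intro mult_left_mono) (auto simp: B_def)
  finally show ?thesis by (simp add: B_def mult.commute)
qed (use assms in \<open>simp only: card.empty of_nat_0, simp\<close>)

text \<open>
  \<open>\<Pi>\<close> depends on the scores only through their order pattern, hence factors through a finite discrete
  space; so it is measurable for every selection rule \<open>F\<close>, measurable or not.
\<close>

lemma check_Pi_measurable:
  fixes B :: "'o \<Rightarrow> ('n::finite, bool) arr"
  assumes B: "\<And>e. (\<lambda>\<omega>. B \<omega> e) \<in> measurable N bool_space"
    and Q: "\<And>e. (\<lambda>\<omega>. Q \<omega> e) \<in> borel_measurable N"
  shows "(\<lambda>\<omega>. check_Pi F a (edges (B \<omega>)) (Q \<omega>) e) \<in> borel_measurable N"
proof -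
  have [measurable]: "Measurable.pred N (\<lambda>\<omega>. B \<omega> e)" for e
    using B[of e] by (simp add: bool_space_def)
  note Q[measurable]
  define g where "g \<omega> = (B \<omega>, {(e, e'). Q \<omega> e \<le> Q \<omega> e'})" for \<omega>
  \<comment> \<open>\<open>SOME\<close> picks a score array with the given order pattern; by
    \<open>check_Pi_order_cong\<close> the value of \<Pi> is the same for every such array.\<close>
  define h where "h = (\<lambda>(b, R). check_Pi F a (edges b)
                          (SOME S :: ('n, real) arr. R = {(e, e'). S e \<le> S e'}) e)"
  have "g \<in> measurable N (count_space UNIV)"
  \<comment> \<open>The codomain of \<open>g\<close> is finite because the node type is, so
    preimages of single points suffice.\<close>
  proof (subst measurable_count_space_eq2, safe)
    fix b R
    have "g -` {(b, R)} \<inter> space N = {\<omega> \<in> space N. (\<forall>e. B \<omega> e \<longleftrightarrow> b e) \<and>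
            (\<forall>e e'. Q \<omega> e \<le> Q \<omega> e' \<longleftrightarrow> (e, e') \<in> R)}"
      by (fastforce simp: g_def)
    also have "\<dots> \<in> sets N" by measurable
    finally show "g -` {(b, R)} \<inter> space N \<in> sets N" .
  qed auto
  then have "(\<lambda>\<omega>. h (g \<omega>)) \<in> borel_measurable N"
    by (rule measurable_compose) simp
  moreover have "h (g \<omega>) = check_Pi F a (edges (B \<omega>)) (Q \<omega>) e" for \<omega>
  proof -
    let ?R = "{(e, e'). Q \<omega> e \<le> Q \<omega> e'}"
    define S where "S = (SOME S :: ('n, real) arr. ?R = {(e, e'). S e \<le> S e'})"
    have "?R = {(e, e'). S e \<le> S e'}"
      unfolding S_def by (rule someI[of _ "Q \<omega>"]) (rule refl)
    then have "check_Pi F a (edges (B \<omega>)) S = check_Pi F a (edges (B \<omega>)) (Q \<omega>)"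
      by (intro check_Pi_order_cong) (auto simp: set_eq_iff)
    then show ?thesis by (simp add: h_def g_def S_def)
  qed
  ultimately show ?thesis by simp
qed

section \<open>Measurability of the training data, the fitted values and the scores\<close>

lemma array_space_component: "(\<lambda>B. B e) \<in> measurable (array_space S) S"
  unfolding array_space_def by (rule measurable_component_singleton) simp

lemma measurable_array_spaceI:
  assumes "\<And>e. (\<lambda>\<omega>. B \<omega> e) \<in> measurable N S"
  shows "B \<in> measurable N (array_space S)"
  unfolding array_space_def
  by (rule measurable_abs_UNIV[where f = "\<lambda>e \<omega>. B \<omega> e", OF assms])

lemma measurable_array_spaceD:
  assumes "B \<in> measurable N (array_space S)"
  shows "(\<lambda>\<omega>. B \<omega> e) \<in> measurable N S"
  using measurable_compose[OF assms array_space_component] .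

lemma option_space_Some: "Some \<in> measurable S (option_space S)"
  unfolding option_space_def
proof (rule measurable_measure_of)
  show "insert {None} ((`) Some ` sets S) \<subseteq> Pow (insert None (Some ` space S))"
  proof safe
    fix A x assume "A \<in> sets S" "x \<in> A" "Some x \<notin> Some ` space S"
    then show "Some x = None" using sets.sets_into_space[of A S] by blast
  qed
  fix A assume "A \<in> insert {None} ((`) Some ` sets S)"
  then consider "A = {None}" | B where "A = Some ` B" "B \<in> sets S" by blast
  then show "Some -` A \<inter> space S \<in> sets S"
  proof cases
    case 1
    then have "Some -` A \<inter> space S = {}" by auto
    then show ?thesis by (simp only: sets.empty_sets)
  qed (simp add: inj_vimage_image_eq)
qed auto

lemma option_space_None: "None \<in> space (option_space S)"
  by (simp add: option_space_def space_measure_of_conv)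

lemma train_split_measurable:
  assumes "\<And>e. (\<lambda>\<omega>. V \<omega> e) \<in> measurable N A" "\<And>e. (\<lambda>\<omega>. Z \<omega> e) \<in> measurable N B"
    and B: "\<And>e. (\<lambda>\<omega>. M1 \<omega> e) \<in> measurable N bool_space"
  shows "(\<lambda>\<omega>. train_split (V \<omega>) (Z \<omega>) (M1 \<omega>))
           \<in> measurable N (array_space (option_space (A \<Otimes>\<^sub>M B)))"
proof (rule measurable_array_spaceI)
  fix e
  have Some: "(\<lambda>\<omega>. Some (V \<omega> e, Z \<omega> e)) \<in> measurable N (option_space (A \<Otimes>\<^sub>M B))"
    using measurable_compose[OF measurable_Pair[OF assms(1,2)] option_space_Some] .
  have None: "(\<lambda>\<omega>. None) \<in> measurable N (option_space (A \<Otimes>\<^sub>M B))"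
    by (rule measurable_const) (rule option_space_None)
  have "(\<lambda>\<omega>. M1 \<omega> e) \<in> measurable N (count_space UNIV)"
    using B[of e] by (simp only: bool_space_def)
  then have "{\<omega> \<in> space N. M1 \<omega> e} \<in> sets N" by (rule predE)
  from measurable_If[OF Some None this]
  show "(\<lambda>\<omega>. train_split (V \<omega>) (Z \<omega>) (M1 \<omega>) e) \<in> measurable N (option_space (A \<Otimes>\<^sub>M B))"
    by (simp only: train_split_def)
qed

text \<open>Recovers the covariate array from \<open>V\<close> and \<open>M\<close>, so that
  everything downstream becomes a function of the exchangeable tuple
  \<open>(V, M, M1, M2)\<close>.\<close>

definition covariates ::
  "('n, ('x, 'e) obs) arr \<Rightarrow> ('n, bool) arr \<Rightarrow> ('n, ('x, 'e) cov) arr" where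
  "covariates V M = (\<lambda>e. (fst (snd (V e)), fst (snd (snd (V e))), snd (snd (snd (V e))), M e))"

lemma covariates_obs_array: "covariates (obs_array Y X E) M = cov_array X E M"
  by (auto simp: covariates_def obs_array_def cov_array_def)

lemma covariates_permute: "covariates (permute \<sigma> V) (permute \<sigma> M) = permute \<sigma> (covariates V M)"
  by (auto simp: covariates_def permute_apply fun_eq_iff)

text \<open>The fitted matrix as a fixed function of the tuple. It can thus be evaluated at a
  relabelled tuple, with the summaries recomputed from the relabelled covariates.\<close>

definition data_fit where
  "data_fit \<zeta> \<mu>h V M M1 M2 =
     fitted \<mu>h (input_split (covariates V M) (\<zeta> (covariates V M)) M2)
               (train_split V (\<zeta> (covariates V M)) M1)"

definition data_scores where
  "data_scores \<zeta> \<mu>h s V M M1 M2 = scores s (\<lambda>e. fst (V e)) (data_fit \<zeta> \<mu>h V M M1 M2)"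

lemma data_fit_measurable:
  fixes V :: "'o \<Rightarrow> ('n::finite, ('x, 'e) obs) arr"
  assumes V[measurable]: "\<And>e. (\<lambda>\<omega>. V \<omega> e) \<in> measurable N (obs_space SX SE)"
    and M[measurable]: "\<And>e. (\<lambda>\<omega>. M \<omega> e) \<in> measurable N bool_space"
    and M1: "\<And>e. (\<lambda>\<omega>. M1 \<omega> e) \<in> measurable N bool_space"
    and M2[measurable]: "\<And>e. (\<lambda>\<omega>. M2 \<omega> e) \<in> measurable N bool_space"
    and \<zeta>: "\<zeta> \<in> measurable (array_space (cov_space SX SE)) (array_space (summ_space SZ SW))"
    and \<mu>h: "(\<lambda>(x, \<tau>). \<mu>h x \<tau>) \<in> borel_measurable (model_space SX SE SZ SW)"
  shows "(\<lambda>\<omega>. data_fit \<zeta> \<mu>h (V \<omega>) (M \<omega>) (M1 \<omega>) (M2 \<omega>) e) \<in> borel_measurable N"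
proof -
  have C[measurable]: "(\<lambda>\<omega>. covariates (V \<omega>) (M \<omega>) e) \<in> measurable N (cov_space SX SE)" for e
    using V[of e] unfolding covariates_def cov_space_def obs_space_def by measurable
  have Z[measurable]: "(\<lambda>\<omega>. \<zeta> (covariates (V \<omega>) (M \<omega>)) e) \<in> measurable N (summ_space SZ SW)" for e
    by (rule measurable_array_spaceD[OF measurable_compose[OF measurable_array_spaceI[OF C] \<zeta>]])
  note T = train_split_measurable[OF V Z M1]
  have "(\<lambda>\<omega>. ((covariates (V \<omega>) (M \<omega>) e, \<zeta> (covariates (V \<omega>) (M \<omega>)) e, M2 \<omega> e),
            train_split (V \<omega>) (\<zeta> (covariates (V \<omega>) (M \<omega>))) (M1 \<omega>)))
          \<in> measurable N (model_space SX SE SZ SW)"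
    unfolding model_space_def by (intro measurable_Pair C Z M2 T)
  from measurable_compose[OF this \<mu>h] show ?thesis
    by (simp add: data_fit_def fitted_def input_split_def)
qed

lemma data_scores_measurable:
  fixes V :: "'o \<Rightarrow> ('n::finite, ('x, 'e) obs) arr"
  assumes V: "\<And>e. (\<lambda>\<omega>. V \<omega> e) \<in> measurable N (obs_space SX SE)"
    and M: "\<And>e. (\<lambda>\<omega>. M \<omega> e) \<in> measurable N bool_space"
    and M1: "\<And>e. (\<lambda>\<omega>. M1 \<omega> e) \<in> measurable N bool_space"
    and M2: "\<And>e. (\<lambda>\<omega>. M2 \<omega> e) \<in> measurable N bool_space"
    and \<zeta>: "\<zeta> \<in> measurable (array_space (cov_space SX SE)) (array_space (summ_space SZ SW))"
    and \<mu>h: "(\<lambda>(x, \<tau>). \<mu>h x \<tau>) \<in> borel_measurable (model_space SX SE SZ SW)"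
    and s: "(\<lambda>(y, m). s y m) \<in> borel_measurable (borel \<Otimes>\<^sub>M borel)"
  shows "(\<lambda>\<omega>. data_scores \<zeta> \<mu>h s (V \<omega>) (M \<omega>) (M1 \<omega>) (M2 \<omega>) e) \<in> borel_measurable N"
proof -
  note data_fit_measurable[OF V M M1 M2 \<zeta> \<mu>h, measurable]
  have [measurable]: "(\<lambda>\<omega>. fst (V \<omega> e)) \<in> borel_measurable N"
    using V[of e] unfolding obs_space_def by measurable
  have "(\<lambda>\<omega>. (fst (V \<omega> e), data_fit \<zeta> \<mu>h (V \<omega>) (M \<omega>) (M1 \<omega>) (M2 \<omega>) e))
          \<in> measurable N (borel \<Otimes>\<^sub>M borel)"
    by measurable
  from measurable_compose[OF this s] show ?thesis
    by (simp add: data_scores_def scores_def)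
qed

section \<open>Relabelling one pair into another, averaging over pairs, and fits under node
  splitting\<close>

text \<open>The first transposition sends \<open>k\<close> to \<open>i\<close> and \<open>l\<close>
  to some \<open>l'\<close> different from \<open>i\<close>; the second sends \<open>l'\<close> to
  \<open>j\<close> and leaves \<open>i\<close> alone because neither \<open>l'\<close> nor
  \<open>j\<close> equals \<open>i\<close>. So the ordered pairs of distinct nodes of
  \<open>A\<close> form a single orbit.\<close>

lemma exists_permutes_pair:
  assumes "i \<in> A" "j \<in> A" "i \<noteq> j" "k \<in> A" "l \<in> A" "k \<noteq> l"
  shows "\<exists>\<sigma>. \<sigma> permutes A \<and> \<sigma> k = i \<and> \<sigma> l = j"
proof -
  define l' where "l' = Transposition.transpose k i l"
  have "l' \<in> A" "l' \<noteq> i"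
    using assms by (auto simp: l'_def Transposition.transpose_def split: if_splits)
  then have "Transposition.transpose l' j \<circ> Transposition.transpose k i permutes A"
    using assms by (intro permutes_compose permutes_swap_id)
  moreover have "(Transposition.transpose l' j \<circ> Transposition.transpose k i) k = i" "(Transposition.transpose l' j \<circ> Transposition.transpose k i) l = j"
    using assms \<open>l' \<noteq> i\<close> by (simp_all add: l'_def)
  ultimately show ?thesis by blast
qed

text \<open>Taking expectations of the two counts compares the sum of all \<open>prob (A e)\<close>
  with \<open>t\<close> times the sum of all \<open>prob (B e)\<close>. Indices with
  \<open>prob (B e) = 0\<close> contribute nothing to either sum, because \<open>A e\<close> is
  contained in \<open>B e\<close>. On the remaining index set \<open>K\<close> both probabilities
  are constant, so dividing by \<open>card K\<close> gives the claim.\<close>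

lemma (in prob_space) prob_le_by_averaging:
  fixes A B :: "'e::finite \<Rightarrow> 'a set"
  assumes [measurable]: "\<And>e. A e \<in> events" "\<And>e. B e \<in> events"
    and sub: "\<And>e. A e \<subseteq> B e"
    and le: "\<And>\<omega>. \<omega> \<in> space M \<Longrightarrow> real (card {e. \<omega> \<in> A e}) \<le> t * real (card {e. \<omega> \<in> B e})"
    and eqA: "\<And>e. prob (B e) > 0 \<Longrightarrow> prob (A e) = prob (A e\<^sub>0)"
    and eqB: "\<And>e. prob (B e) > 0 \<Longrightarrow> prob (B e) = prob (B e\<^sub>0)"
    and pos: "prob (B e\<^sub>0) > 0"
  shows "prob (A e\<^sub>0) \<le> t * prob (B e\<^sub>0)"
proof -
  define K where "K = {e. prob (B e) > 0}"
  have card: "real (card {e. \<omega> \<in> C e}) = (\<Sum>e\<in>UNIV. indicator (C e) \<omega>)" for C :: "'e \<Rightarrow> 'a set" and \<omega>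
    by (simp add: indicator_def sum_of_bool_eq)
  have null: "prob (A e) = 0" "prob (B e) = 0" if "e \<notin> K" for e
  proof -
    show "prob (B e) = 0" using that by (simp add: K_def not_less measure_le_0_iff)
    then show "prob (A e) = 0"
      using finite_measure_mono[OF sub[of e]] by (simp add: measure_le_0_iff)
  qed
  have K: "finite K" "e\<^sub>0 \<in> K" using pos by (auto simp: K_def)
  have "real (card K) * prob (A e\<^sub>0) = (\<Sum>e\<in>K. prob (A e\<^sub>0))"
    by simp
  also have "\<dots> = (\<Sum>e\<in>K. prob (A e))"
    using eqA by (intro sum.cong) (auto simp: K_def)
  also have "\<dots> = (\<Sum>e\<in>UNIV. prob (A e))"
    using null by (intro sum.mono_neutral_left) auto
  also have "\<dots> = expectation (\<lambda>\<omega>. \<Sum>e\<in>UNIV. indicator (A e) \<omega>)"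
    by (subst Bochner_Integration.integral_sum) (auto simp: emeasure_eq_measure)
  \<comment> \<open>The only inequality in the chain: the pointwise bound between the counts, under
    the expectation.\<close>
  also have "\<dots> \<le> expectation (\<lambda>\<omega>. t * (\<Sum>e\<in>UNIV. indicator (B e) \<omega>))"
    using le by (intro integral_mono integrable_mult_right Bochner_Integration.integrable_sum)
      (auto simp: card emeasure_eq_measure)
  also have "\<dots> = t * (\<Sum>e\<in>UNIV. prob (B e))"
    by (subst integral_mult_right_zero, subst Bochner_Integration.integral_sum)
       (auto simp: emeasure_eq_measure)
  also have "(\<Sum>e\<in>UNIV. prob (B e)) = (\<Sum>e\<in>K. prob (B e))"
    using null by (intro sum.mono_neutral_right) auto
  also have "\<dots> = (\<Sum>e\<in>K. prob (B e\<^sub>0))"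
    using eqB by (intro sum.cong) (auto simp: K_def)
  finally have "real (card K) * prob (A e\<^sub>0) \<le> real (card K) * (t * prob (B e\<^sub>0))"
    by (simp add: mult_ac)
  moreover have "real (card K) > 0" using K by (auto simp: card_gt_0_iff)
  ultimately show ?thesis by simp
qed

text \<open>Training pairs have both endpoints in \<open>D\<close>, where \<sigma> is the identity.
  Relabelling therefore leaves the training family literally unchanged, and the same fitted function
  is applied to the permuted inputs.\<close>

lemma data_fit_permute:
  fixes \<sigma> :: "'n \<Rightarrow> 'n"
  assumes \<sigma>: "\<sigma> permutes A" "A \<inter> D = {}"
    and M1: "\<And>i j. M1 (i, j) \<Longrightarrow> i \<in> D \<and> j \<in> D"
    and Z: "permute \<sigma> (\<zeta> (covariates V M)) = \<zeta> (permute \<sigma> (covariates V M))"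
  shows "data_fit \<zeta> \<mu>h (permute \<sigma> V) (permute \<sigma> M) (permute \<sigma> M1) (permute \<sigma> M2)
           = permute \<sigma> (data_fit \<zeta> \<mu>h V M M1 M2)"
proof -
  \<comment> \<open>If \<open>\<sigma> i\<close> lies in \<open>D\<close>, then \<sigma> fixes
    \<open>\<sigma> i\<close>, and injectivity gives \<open>\<sigma> i = i\<close>.\<close>
  have fixed: "\<sigma> i = i" if "i \<in> D \<or> \<sigma> i \<in> D" for i
    using that \<sigma> by (metis disjoint_iff permutes_def)
  have train: "train_split (permute \<sigma> V) (permute \<sigma> W) (permute \<sigma> M1) = train_split V W M1"
    for W :: "('n, 'w) arr"
  proof
    fix e :: "'n \<times> 'n"
    obtain i j where e: "e = (i, j)" by fastforce
    show "train_split (permute \<sigma> V) (permute \<sigma> W) (permute \<sigma> M1) e = train_split V W M1 e"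
    proof (cases "\<sigma> i = i \<and> \<sigma> j = j")
      case True
      then show ?thesis by (simp add: e train_split_def permute_def)
    next
      case False
      \<comment> \<open>When an endpoint moves, neither the pair nor its image is a training pair,
        so both families have the value \<open>None\<close> there.\<close>
      then have "\<not> M1 (i, j)" "\<not> M1 (\<sigma> i, \<sigma> j)" using M1 fixed by blast+
      then show ?thesis by (simp add: e train_split_def permute_def)
    qed
  qed
  show ?thesis
    unfolding data_fit_def covariates_permute Z[symmetric]
    by (rule ext) (simp add: train fitted_def input_split_def permute_apply)
qed

section \<open>Validity of \<Pi> and coverage of the prediction set\<close>

theorem theorem4p3:
  fixes P :: "'o measure"
    and SX :: "'x measure" and SE :: "'e measure" and SZ :: "'z measure" and SW :: "'w measure"
    and Y :: "'o \<Rightarrow> ('n::finite, real) arr"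
    and X :: "'o \<Rightarrow> 'n \<Rightarrow> 'x"
    and E :: "'o \<Rightarrow> ('n, 'e) arr"
    and M M1 M2 :: "'o \<Rightarrow> ('n, bool) arr"
    and V :: "'o \<Rightarrow> ('n, ('x, 'e) obs) arr"
    and \<X> :: "'o \<Rightarrow> ('n, ('x, 'e) cov) arr"
    and \<zeta> :: "('n, ('x, 'e) cov) arr \<Rightarrow> ('n, ('z, 'w) summ) arr"
    and Z :: "'o \<Rightarrow> ('n, ('z, 'w) summ) arr"
    and \<mu>h :: "('x, 'e) cov \<times> ('z, 'w) summ \<times> bool \<Rightarrow>
               ('n, (('x, 'e) obs \<times> ('z, 'w) summ) option) arr \<Rightarrow> real"
    and fit S :: "'o \<Rightarrow> ('n, real) arr"
    and s :: "real \<Rightarrow> real \<Rightarrow> real"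
    and F :: "(real \<times> real) pmf \<Rightarrow> (real \<times> real) pmf \<Rightarrow> real \<times> real \<Rightarrow> real \<times> real"
    and a :: "nat \<Rightarrow> nat \<Rightarrow> real \<times> real"
    and symm :: bool
    and k l :: 'n
  assumes prob: "prob_space P"
    and meas_Y: "\<And>e. (\<lambda>\<omega>. Y \<omega> e) \<in> borel_measurable P"
    and meas_X: "\<And>i. (\<lambda>\<omega>. X \<omega> i) \<in> measurable P SX"
    and meas_E: "\<And>e. (\<lambda>\<omega>. E \<omega> e) \<in> measurable P SE"
    and meas_M: "\<And>e. (\<lambda>\<omega>. M \<omega> e) \<in> measurable P bool_space"
    and meas_M1: "\<And>e. (\<lambda>\<omega>. M1 \<omega> e) \<in> measurable P bool_space"
    and meas_M2: "\<And>e. (\<lambda>\<omega>. M2 \<omega> e) \<in> measurable P bool_space"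
    and meas_\<zeta>: "\<zeta> \<in> measurable (array_space (cov_space SX SE)) (array_space (summ_space SZ SW))"
    and meas_\<mu>h: "(\<lambda>(x, \<tau>). \<mu>h x \<tau>) \<in> borel_measurable (model_space SX SE SZ SW)"
    and meas_s: "(\<lambda>(y, m). s y m) \<in> borel_measurable (borel \<Otimes>\<^sub>M borel)"
    and V_eq: "V = (\<lambda>\<omega>. obs_array (Y \<omega>) (X \<omega>) (E \<omega>))"
    and X_eq: "\<X> = (\<lambda>\<omega>. cov_array (X \<omega>) (E \<omega>) (M \<omega>))"
    and Z_eq: "Z = (\<lambda>\<omega>. \<zeta> (\<X> \<omega>))"
    and Z_entries: "\<And>x. x \<in> space (array_space (cov_space SX SE)) \<Longrightarrow> \<exists>u w. \<zeta> x = summ_array u w"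
    and fit_eq: "fit = (\<lambda>\<omega>. fitted \<mu>h (input_split (\<X> \<omega>) (Z \<omega>) (M2 \<omega>))
                                     (train_split (V \<omega>) (Z \<omega>) (M1 \<omega>)))"
    and S_eq: "S = (\<lambda>\<omega>. scores s (Y \<omega>) (fit \<omega>))"
    and symm: "symm \<Longrightarrow> AE \<omega> in P. \<forall>i j. Y \<omega> (i, j) = Y \<omega> (j, i)"
    and no_loops: "AE \<omega> in P. \<forall>i. \<not> M2 \<omega> (i, i)"
    and opt: "optimal_map_rule F"
    and cond1: "exchangeable_split P SX SE V M M1 M2"
    and cond1': "AE \<omega> in P. \<forall>e. (of_bool (M \<omega> e) :: nat) \<ge> of_bool (M1 \<omega> e) + of_bool (M2 \<omega> e)"
    and cond2: "\<And>\<sigma>. \<sigma> permutes UNIV \<Longrightarrow>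
                  AE \<omega> in P. permute \<sigma> (Z \<omega>) = \<zeta> (permute \<sigma> (\<X> \<omega>))"
    and cond3: "node_splitting P M M1 M2 \<or>
                (\<forall>\<sigma>. \<sigma> permutes UNIV \<longrightarrow>
                   (AE \<omega> in P. permute \<sigma> (fit \<omega>) =
                      fitted \<mu>h
                        (input_split (permute \<sigma> (\<X> \<omega>)) (permute \<sigma> (Z \<omega>)) (permute \<sigma> (M2 \<omega>)))
                        (train_split (permute \<sigma> (V \<omega>)) (permute \<sigma> (Z \<omega>)) (permute \<sigma> (M1 \<omega>)))))"
    and pos: "measure P {\<omega> \<in> space P. M2 \<omega> (k, l)} > 0"
  shows "(\<forall>t. 0 \<le> t \<and> t \<le> 1 \<longrightarrow>
            cond_prob P (\<lambda>\<omega>. check_Pi F a (edges (M2 \<omega>)) (S \<omega>) (k, l) \<le> t)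
                        (\<lambda>\<omega>. M2 \<omega> (k, l)) \<le> t)
       \<and> (\<forall>\<alpha>. 0 \<le> \<alpha> \<and> \<alpha> \<le> 1 \<longrightarrow>
            cond_prob P (\<lambda>\<omega>. Y \<omega> (k, l) \<in>
                           row_col_set F a s symm \<alpha> (edges (M2 \<omega>)) (fit \<omega>) (Y \<omega>) (k, l))
                        (\<lambda>\<omega>. M2 \<omega> (k, l)) \<ge> 1 - \<alpha>)"
proof -
  interpret prob_space P by (rule prob)
  note meas_Y[measurable] meas_X[measurable] meas_E[measurable]
  define e\<^sub>0 where "e\<^sub>0 = (k, l)"
  define A where "A = active_nodes P M2"
  let ?Pi = "\<lambda>\<omega>. check_Pi F a (edges (M2 \<omega>)) (S \<omega>)"
  let ?H = "\<lambda>e. {\<omega> \<in> space P. M2 \<omega> e}"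
  have pred_M2[measurable]: "Measurable.pred P (\<lambda>\<omega>. M2 \<omega> e)" for e
    using meas_M2[of e] by (simp add: bool_space_def)
  have meas_V: "(\<lambda>\<omega>. V \<omega> e) \<in> measurable P (obs_space SX SE)" for e
    unfolding V_eq obs_array_def obs_space_def by (cases e) simp
  \<comment> \<open>Fits and scores are rewritten as fixed functions of the tuple, which is the form
    in which equality in distribution can be applied to them.\<close>
  have fit: "fit \<omega> = data_fit \<zeta> \<mu>h (V \<omega>) (M \<omega>) (M1 \<omega>) (M2 \<omega>)" for \<omega>
    by (simp add: fit_eq data_fit_def Z_eq X_eq V_eq covariates_obs_array)
  have S: "S \<omega> = data_scores \<zeta> \<mu>h s (V \<omega>) (M \<omega>) (M1 \<omega>) (M2 \<omega>)" for \<omega>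
    by (simp add: S_eq data_scores_def fit scores_def fun_eq_iff)
       (simp add: V_eq obs_array_def case_prod_beta)
  have meas_fit[measurable]: "(\<lambda>\<omega>. fit \<omega> e) \<in> borel_measurable P" for e
    unfolding fit by (rule data_fit_measurable[OF meas_V meas_M meas_M1 meas_M2 meas_\<zeta> meas_\<mu>h])
  have meas_S: "(\<lambda>\<omega>. S \<omega> e) \<in> borel_measurable P" for e
    unfolding S
    by (rule data_scores_measurable[OF meas_V meas_M meas_M1 meas_M2 meas_\<zeta> meas_\<mu>h meas_s])
  have meas_Pi[measurable]: "(\<lambda>\<omega>. ?Pi \<omega> e) \<in> borel_measurable P" for e
    by (rule check_Pi_measurable[OF meas_M2 meas_S])

  \<comment> \<open>An active node may be either endpoint of a calibration pair, so both endpoints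
    of a pair with positive probability lie in \<open>A\<close>. Diagonal pairs would form a second
    orbit under relabelling; \<open>no_loops\<close> excludes them.\<close>
  have A_imp: "i \<in> A \<and> j \<in> A \<and> i \<noteq> j" if "prob (?H (i, j)) > 0" for i j
  proof (intro conjI notI)
    have "prob (?H (i, j)) \<le> prob {\<omega> \<in> space P. \<exists>j. M2 \<omega> (i, j) \<or> M2 \<omega> (j, i)}"
         "prob (?H (i, j)) \<le> prob {\<omega> \<in> space P. \<exists>i. M2 \<omega> (j, i) \<or> M2 \<omega> (i, j)}"
      by (intro finite_measure_mono; auto)+
    with that show "i \<in> A" "j \<in> A" by (auto simp: A_def active_nodes_def)
    assume "i = j"
    with no_loops have "AE \<omega> in P. \<not> M2 \<omega> (i, j)" by auto
    then have "prob (?H (i, j)) = 0" by (subst prob_eq_0) auto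
    with that show False by simp
  qed

  \<comment> \<open>Both alternatives of \<open>cond3\<close> lead to the same statement: almost
    surely, the fit of the relabelled data is the relabelled fit. The scores inherit this, being
    entrywise in the response and the fit.\<close>
  have scores_permute: "AE \<omega> in P. data_scores \<zeta> \<mu>h s (permute \<sigma> (V \<omega>)) (permute \<sigma> (M \<omega>))
      (permute \<sigma> (M1 \<omega>)) (permute \<sigma> (M2 \<omega>)) = permute \<sigma> (S \<omega>)"
    if \<sigma>: "\<sigma> permutes A" for \<sigma>
  proof -
    have \<sigma>': "\<sigma> permutes UNIV" using \<sigma> by (rule permutes_subset) simp
    have XC: "\<X> \<omega> = covariates (V \<omega>) (M \<omega>)" for \<omega>
      by (simp add: X_eq V_eq covariates_obs_array)
    have "AE \<omega> in P. data_fit \<zeta> \<mu>h (permute \<sigma> (V \<omega>)) (permute \<sigma> (M \<omega>))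
        (permute \<sigma> (M1 \<omega>)) (permute \<sigma> (M2 \<omega>)) = permute \<sigma> (fit \<omega>)"
      using cond3
    proof (elim disjE)
      assume "node_splitting P M M1 M2"
      then obtain D1 D2 where D: "D1 \<union> D2 = UNIV" "D1 \<inter> D2 = {}"
        and split: "AE \<omega> in P. \<forall>i j.
           (M1 \<omega> (i, j) \<longleftrightarrow> M \<omega> (i, j) \<and> i \<in> D1 \<and> j \<in> D1) \<and>
           (M2 \<omega> (i, j) \<longleftrightarrow> M \<omega> (i, j) \<and> i \<in> D2 \<and> j \<in> D2)"
        unfolding node_splitting_def by - (elim exE conjE, rule that)
      \<comment> \<open>Almost surely every calibration pair has both endpoints in
        \<open>D2\<close>, so a node of \<open>D1\<close> touches no such pair and is not
        active.\<close>
      have AD: "A \<inter> D1 = {}"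
      proof (rule ccontr)
        assume "A \<inter> D1 \<noteq> {}"
        then obtain i where i: "i \<in> A" "i \<in> D1" by blast
        have "AE \<omega> in P. \<not> (\<exists>j. M2 \<omega> (i, j) \<or> M2 \<omega> (j, i))"
          using split by eventually_elim (use i(2) D in blast)
        then have "prob {\<omega> \<in> space P. \<exists>j. M2 \<omega> (i, j) \<or> M2 \<omega> (j, i)} = 0"
          by (subst prob_eq_0) auto
        with i(1) show False by (simp add: A_def active_nodes_def)
      qed
      show ?thesis
        using split cond2[OF \<sigma>']
      proof eventually_elim
        case (elim \<omega>)
        then show ?case
          unfolding fit by (intro data_fit_permute[OF \<sigma> AD]) (auto simp: Z_eq XC)
      qed
    next
      assume "\<forall>\<sigma>. \<sigma> permutes UNIV \<longrightarrow>
         (AE \<omega> in P. permute \<sigma> (fit \<omega>) =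
            fitted \<mu>h
              (input_split (permute \<sigma> (\<X> \<omega>)) (permute \<sigma> (Z \<omega>)) (permute \<sigma> (M2 \<omega>)))
              (train_split (permute \<sigma> (V \<omega>)) (permute \<sigma> (Z \<omega>)) (permute \<sigma> (M1 \<omega>))))"
      with \<sigma>' have "AE \<omega> in P. permute \<sigma> (fit \<omega>) =
            fitted \<mu>h
              (input_split (permute \<sigma> (\<X> \<omega>)) (permute \<sigma> (Z \<omega>)) (permute \<sigma> (M2 \<omega>)))
              (train_split (permute \<sigma> (V \<omega>)) (permute \<sigma> (Z \<omega>)) (permute \<sigma> (M1 \<omega>)))"
        by blast
      \<comment> \<open>Here \<open>cond2\<close> replaces the permuted summaries by those computed
        from the permuted covariates, as \<open>data_fit\<close> requires.\<close>
      then show ?thesis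
        using cond2[OF \<sigma>']
        by eventually_elim (simp add: data_fit_def covariates_permute XC)
    qed
    then show ?thesis
      by eventually_elim
         (auto simp: data_scores_def S_eq scores_def permute_apply fun_eq_iff V_eq obs_array_def
            map_prod_def split: prod.splits)
  qed

  \<comment> \<open>The bound is first proved without conditioning, by averaging over all pairs
    \<open>e\<close> with the events \<open>\<Pi>(e) \<le> t\<close> and \<open>M2 e\<close> for
    \<open>A e\<close>, and \<open>M2 e\<close> for \<open>B e\<close>. Both claims of the theorem
    follow from it.\<close>
  have bound: "prob {\<omega> \<in> space P. ?Pi \<omega> e\<^sub>0 \<le> t \<and> M2 \<omega> e\<^sub>0} \<le> t * prob (?H e\<^sub>0)"
    if "0 \<le> t" for t
  proof (rule prob_le_by_averaging)
    have inv: "prob {\<omega> \<in> space P. ?Pi \<omega> e \<le> t \<and> M2 \<omega> e} =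
               prob {\<omega> \<in> space P. ?Pi \<omega> e\<^sub>0 \<le> t \<and> M2 \<omega> e\<^sub>0} \<and> prob (?H e) = prob (?H e\<^sub>0)"
      if e: "prob (?H e) > 0" for e
    proof -
      obtain i j where ij: "e = (i, j)" by fastforce
      obtain \<sigma> where \<sigma>: "\<sigma> permutes A" "\<sigma> k = i" "\<sigma> l = j"
        using exists_permutes_pair[of i A j k l] A_imp[of i j] A_imp[of k l] e pos ij by auto
      have bij: "bij \<sigma>" using \<sigma>(1) by (rule permutes_bij)
      have \<sigma>e: "map_prod \<sigma> \<sigma> e\<^sub>0 = e" using \<sigma> by (simp add: e\<^sub>0_def ij)
      define \<Omega> where "\<Omega> = (data_space SX SE :: (('n, ('x, 'e) obs) arr \<times> _) measure)"
      define f where "f \<omega> = (V \<omega>, M \<omega>, M1 \<omega>, M2 \<omega>)" for \<omega>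
      define g where "g \<omega> = (permute \<sigma> (V \<omega>), permute \<sigma> (M \<omega>), permute \<sigma> (M1 \<omega>),
                             permute \<sigma> (M2 \<omega>))" for \<omega>
      have [measurable]: "f \<in> measurable P \<Omega>" "g \<in> measurable P \<Omega>"
        unfolding f_def g_def \<Omega>_def data_space_def
        by (intro measurable_Pair measurable_array_spaceI;
            simp add: permute_apply meas_V meas_M meas_M1 meas_M2)+
      have distr: "distr P \<Omega> g = distr P \<Omega> f"
        using cond1 \<sigma>(1) by (simp add: exchangeable_split_def A_def \<Omega>_def f_def[abs_def] g_def[abs_def])
      have comp: "(\<lambda>w. fst w e) \<in> measurable \<Omega> (obs_space SX SE)"
        "(\<lambda>w. fst (snd w) e) \<in> measurable \<Omega> bool_space"
        "(\<lambda>w. fst (snd (snd w)) e) \<in> measurable \<Omega> bool_space"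
        "(\<lambda>w. snd (snd (snd w)) e) \<in> measurable \<Omega> bool_space" for e
        unfolding \<Omega>_def data_space_def by (rule measurable_array_spaceD; measurable)+
      \<comment> \<open>This is \<Pi> at the fixed pair \<open>e\<^sub>0\<close> as a function of
        the tuple. At the original tuple \<open>f \<omega>\<close> it is \<Pi> at
        \<open>e\<^sub>0\<close>; at the relabelled tuple \<open>g \<omega>\<close> it is almost
        surely \<Pi> at \<open>e\<close>, by equivariance and
        \<open>map_prod \<sigma> \<sigma> e\<^sub>0 = e\<close>. Equality of the two laws then
        equates the probabilities.\<close>
      define pi where "pi w = check_Pi F a (edges (snd (snd (snd w))))
          (data_scores \<zeta> \<mu>h s (fst w) (fst (snd w)) (fst (snd (snd w))) (snd (snd (snd w)))) e\<^sub>0" for w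
      have [measurable]: "pi \<in> borel_measurable \<Omega>"
        unfolding pi_def
        by (intro check_Pi_measurable data_scores_measurable[OF _ _ _ _ meas_\<zeta> meas_\<mu>h meas_s] comp)
      have [measurable]: "Measurable.pred \<Omega> (\<lambda>w. snd (snd (snd w)) e\<^sub>0)"
        using comp(4)[of e\<^sub>0] by (simp add: bool_space_def)
      have transfer: "prob {\<omega> \<in> space P. Q (f \<omega>)} = prob {\<omega> \<in> space P. Q (g \<omega>)}"
        if [measurable]: "Measurable.pred \<Omega> Q" for Q
      proof -
        have "measure (distr P \<Omega> f) {w \<in> space \<Omega>. Q w} = measure (distr P \<Omega> g) {w \<in> space \<Omega>. Q w}"
          by (simp add: distr)
        moreover have "f -` {w \<in> space \<Omega>. Q w} \<inter> space P = {\<omega> \<in> space P. Q (f \<omega>)}"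
                      "g -` {w \<in> space \<Omega>. Q w} \<inter> space P = {\<omega> \<in> space P. Q (g \<omega>)}"
          using measurable_space[OF \<open>f \<in> measurable P \<Omega>\<close>]
            measurable_space[OF \<open>g \<in> measurable P \<Omega>\<close>] by auto
        ultimately show ?thesis by (simp add: measure_distr)
      qed
      have "prob {\<omega> \<in> space P. pi (g \<omega>) \<le> t \<and> snd (snd (snd (g \<omega>))) e\<^sub>0} =
            prob {\<omega> \<in> space P. ?Pi \<omega> e \<le> t \<and> M2 \<omega> e}"
      proof (rule finite_measure_eq_AE)
        show "AE \<omega> in P. (\<omega> \<in> {\<omega> \<in> space P. pi (g \<omega>) \<le> t \<and> snd (snd (snd (g \<omega>))) e\<^sub>0}) =
                         (\<omega> \<in> {\<omega> \<in> space P. ?Pi \<omega> e \<le> t \<and> M2 \<omega> e})"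
          using scores_permute[OF \<sigma>(1)]
          by eventually_elim
             (simp add: pi_def g_def edges_permute check_Pi_permute[OF bij] \<sigma>e permute_apply)
      qed measurable
      moreover have "prob {\<omega> \<in> space P. ?Pi \<omega> e\<^sub>0 \<le> t \<and> M2 \<omega> e\<^sub>0} =
            prob {\<omega> \<in> space P. pi (g \<omega>) \<le> t \<and> snd (snd (snd (g \<omega>))) e\<^sub>0}"
      proof -
        have f: "pi (f \<omega>) = ?Pi \<omega> e\<^sub>0" "snd (snd (snd (f \<omega>))) e\<^sub>0 = M2 \<omega> e\<^sub>0" for \<omega>
          by (simp_all only: pi_def f_def fst_conv snd_conv S)
        have "Measurable.pred \<Omega> (\<lambda>w. pi w \<le> t \<and> snd (snd (snd w)) e\<^sub>0)"
          by measurable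
        from transfer[OF this] show ?thesis by (simp only: f)
      qed
      moreover have "prob (?H e\<^sub>0) = prob (?H e)"
        using transfer[OF \<open>Measurable.pred \<Omega> (\<lambda>w. snd (snd (snd w)) e\<^sub>0)\<close>]
        by (simp only: f_def g_def snd_conv permute_apply \<sigma>e)
      ultimately show ?thesis by simp
    qed
    show "prob {\<omega> \<in> space P. ?Pi \<omega> e \<le> t \<and> M2 \<omega> e} =
          prob {\<omega> \<in> space P. ?Pi \<omega> e\<^sub>0 \<le> t \<and> M2 \<omega> e\<^sub>0}"
      "prob (?H e) = prob (?H e\<^sub>0)" if "prob (?H e) > 0" for e
      using inv[OF that] by blast+
    show "real (card {e. \<omega> \<in> {\<omega> \<in> space P. ?Pi \<omega> e \<le> t \<and> M2 \<omega> e}}) \<le>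
          t * real (card {e. \<omega> \<in> ?H e})" if "\<omega> \<in> space P" for \<omega>
      using card_check_Pi_le[OF \<open>0 \<le> t\<close>, where H = "edges (M2 \<omega>)" and S = "S \<omega>" and F = F and a = a] that
      by (simp add: edges_def conj_commute)
    show "prob (?H e\<^sub>0) > 0" using pos by (simp add: e\<^sub>0_def)
  qed auto

  have part1: "cond_prob P (\<lambda>\<omega>. ?Pi \<omega> e\<^sub>0 \<le> t) (\<lambda>\<omega>. M2 \<omega> e\<^sub>0) \<le> t" if "0 \<le> t" for t
    using bound[OF that] pos by (simp add: cond_prob_def e\<^sub>0_def divide_le_eq)

  have part2: "cond_prob P (\<lambda>\<omega>. Y \<omega> e\<^sub>0 \<in>
        row_col_set F a s symm \<alpha> (edges (M2 \<omega>)) (fit \<omega>) (Y \<omega>) e\<^sub>0) (\<lambda>\<omega>. M2 \<omega> e\<^sub>0) \<ge> 1 - \<alpha>"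
    if \<alpha>: "0 \<le> \<alpha>" for \<alpha>
  proof -
    \<comment> \<open>Membership of the observed response in the prediction set substitutes that
      response for itself. In the symmetric case this also overwrites the transposed entry, so
      \<open>Y'\<close> agrees with \<open>Y\<close> only almost surely.\<close>
    define Y' where "Y' \<omega> = subst_response symm e\<^sub>0 (Y \<omega> e\<^sub>0) (Y \<omega>)" for \<omega>
    define Pi' where "Pi' \<omega> = check_Pi F a (edges (M2 \<omega>)) (scores s (Y' \<omega>) (fit \<omega>)) e\<^sub>0" for \<omega>
    have Y'[measurable]: "(\<lambda>\<omega>. Y' \<omega> e) \<in> borel_measurable P" for e
      by (cases symm) (simp_all add: Y'_def subst_response_def fun_upd_def)
    have "(\<lambda>\<omega>. (Y' \<omega> e, fit \<omega> e)) \<in> measurable P (borel \<Otimes>\<^sub>M borel)" for e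
      by measurable
    from measurable_compose[OF this meas_s]
    have [measurable]: "Pi' \<in> borel_measurable P"
      unfolding Pi'_def by (intro check_Pi_measurable meas_M2) (simp add: scores_def)
    have "AE \<omega> in P. Y' \<omega> = Y \<omega>"
    proof (cases symm)
      case True
      from symm[OF this] show ?thesis
        by eventually_elim (auto simp: Y'_def subst_response_def e\<^sub>0_def)
    qed (simp add: Y'_def subst_response_def)
    then have "AE \<omega> in P. Pi' \<omega> = ?Pi \<omega> e\<^sub>0"
      by eventually_elim (simp add: Pi'_def S_eq)
    then have "prob {\<omega> \<in> space P. Pi' \<omega> \<le> \<alpha> \<and> M2 \<omega> e\<^sub>0} =
               prob {\<omega> \<in> space P. ?Pi \<omega> e\<^sub>0 \<le> \<alpha> \<and> M2 \<omega> e\<^sub>0}"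
      by (intro finite_measure_eq_AE) auto
    \<comment> \<open>Coverage and failure split the event that \<open>e\<^sub>0\<close> is a
      calibration pair; the failure part is controlled by \<open>bound\<close> at level
      \<alpha>.\<close>
    moreover have "prob (?H e\<^sub>0) = prob {\<omega> \<in> space P. Pi' \<omega> > \<alpha> \<and> M2 \<omega> e\<^sub>0} +
                   prob {\<omega> \<in> space P. Pi' \<omega> \<le> \<alpha> \<and> M2 \<omega> e\<^sub>0}"
      by (subst finite_measure_Union[symmetric]) (auto intro!: arg_cong[of _ _ prob])
    ultimately have "prob {\<omega> \<in> space P. Pi' \<omega> > \<alpha> \<and> M2 \<omega> e\<^sub>0} \<ge> (1 - \<alpha>) * prob (?H e\<^sub>0)"
      using bound[OF \<alpha>] by (simp add: algebra_simps)
    then show ?thesis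
      using pos by (simp add: cond_prob_def row_col_set_def Pi'_def Y'_def e\<^sub>0_def le_divide_eq)
  qed
  show ?thesis
    using part1 part2 by (simp add: e\<^sub>0_def)
qed

end
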